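(* Let $(V,A)$ be a finite directed network with source $s\in V$ and sink $t\in V$, $s\ne t$, and let $\mathcal{C}$ be the set of all $s$-$t$ cuts, each regarded as a subset $C\subseteq A$ of arcs. Let $d\in\mathbb{R}$, $\Omega\ge 0$, and for each $a\in A$ let $\mu_a\in\mathbb{R}$ and $\sigma_a\ge 0$ satisfy $\mu_a\ge\Omega\,\sigma_a$. Let $\mathbf{D}$ be the diagonal matrix with entries $D_{aa}=\sigma_a^2$, and for $C\in\mathcal{C}$ let $\boldsymbol{\mu}_C$ and $\mathbf{D}_C$ be obtained from $\boldsymbol{\mu}=(\mu_a)_{a\in A}$ and $\mathbf{D}$ by replacing with zero all entries corresponding to arcs not in $C$. For $C\in\mathcal{C}$ define $f_C:\{0,1\}^A\to\mathbb{R}$ by $$f_C(\mathbf{x})=\sum_{a\in C}\mu_a x_a-\Omega\sqrt{\sum_{a\in C}\sigma_a^2x_a}.$$ Then each $f_C$, $C\in\mathcal{C}$, is a non-decreasing supermodular set function on $A$, and $$\Big\{\mathbf{x}\in\{0,1\}^A:\ \boldsymbol{\mu}_C'\mathbf{x}-\Omega\,\big\|\mathbf{D}_C^{1/2}\mathbf{x}\big\|_2\ge d\ \text{ for all } C\in\mathcal{C}\Big\}=\bigcap_{C\in\mathcal{C}}\big\{\mathbf{x}\in\{0,1\}^A:\ f_C(\mathbf{x})\ge d\big\}.$$ That is, the feasible set is the intersection of monotone supermodular covering knapsack sets.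
   Context: An $s$-$t$ cut is the set of arcs going from $U$ to $V\setminus U$ for some $U\subseteq V$ with $s\in U$, $t\notin U$. Functions on $\{0,1\}^A$ are identified with set functions on $A$ via characteristic vectors. A set function $g:2^A\to\mathbb{R}$ is supermodular if, for every $i\in A$ and all $S\subseteq T\subseteq A\setminus\{i\}$, $g(S\cup\{i\})-g(S)\le g(T\cup\{i\})-g(T)$; it is non-decreasing if $g(S)\le g(T)$ whenever $S\subseteq T$. A supermodular covering knapsack set is a set of the form $\{\mathbf{x}\in\{0,1\}^A: g(\mathbf{x})\ge d\}$ with $g$ supermodular; it is called monotone when $g$ is non-decreasing. A prime denotes transpose. *)

theory Defs
  imports "HOL-Analysis.Analysis" "Graph_Theory.Digraph"
begin

section \<open>Cuts\<close>

definition st_cuts :: "('v, 'a) pre_digraph \<Rightarrow> 'v \<Rightarrow> 'v \<Rightarrow> 'a set set" where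
  "st_cuts G s t =
     {{a \<in> arcs G. tail G a \<in> U \<and> head G a \<in> verts G - U} | U.
        U \<subseteq> verts G \<and> s \<in> U \<and> t \<notin> U}"

section \<open>Binary vectors and set functions on \<open>A\<close>\<close>

text \<open>Vectors indexed by a finite set \<open>A\<close> of arcs are elements of \<open>real ^ 'a\<close>, where the finite
  type \<open>'a\<close> contains \<open>A\<close>; the set \<open>A\<close> may be a proper subset of the type (in particular it may
  be empty). Binary vectors on \<open>A\<close> are padded with zeros outside \<open>A\<close>.\<close>

definition binary_vectors :: "'a set \<Rightarrow> (real ^ 'a) set" where
  "binary_vectors A = {x. (\<forall>a\<in>A. x $ a \<in> {0, 1}) \<and> (\<forall>a. a \<notin> A \<longrightarrow> x $ a = 0)}"

definition char_vec :: "'a set \<Rightarrow> real ^ 'a" where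
  "char_vec S = (\<chi> a. indicator S a)"

definition set_function :: "(real ^ 'a \<Rightarrow> real) \<Rightarrow> 'a set \<Rightarrow> real" where
  "set_function f S = f (char_vec S)"

definition supermodular_on :: "'a set \<Rightarrow> ('a set \<Rightarrow> real) \<Rightarrow> bool" where
  "supermodular_on A g \<longleftrightarrow>
     (\<forall>i\<in>A. \<forall>S T. S \<subseteq> T \<and> T \<subseteq> A - {i} \<longrightarrow> g (S \<union> {i}) - g S \<le> g (T \<union> {i}) - g T)"

definition nondecreasing_on :: "'a set \<Rightarrow> ('a set \<Rightarrow> real) \<Rightarrow> bool" where
  "nondecreasing_on A g \<longleftrightarrow> (\<forall>S T. S \<subseteq> T \<and> T \<subseteq> A \<longrightarrow> g S \<le> g T)"

definition monotone_supermodular_covering_knapsack :: "'a set \<Rightarrow> (real ^ 'a) set \<Rightarrow> bool" where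
  "monotone_supermodular_covering_knapsack A K \<longleftrightarrow>
     (\<exists>g d. supermodular_on A (set_function g) \<and> nondecreasing_on A (set_function g) \<and>
            K = {x \<in> binary_vectors A. g x \<ge> d})"

section \<open>Restriction to a cut and matrix square roots\<close>

definition restrict_vec :: "'a set \<Rightarrow> real ^ 'a \<Rightarrow> real ^ 'a" where
  "restrict_vec C v = (\<chi> a. if a \<in> C then v $ a else 0)"

definition restrict_mat :: "'a set \<Rightarrow> real ^ 'a ^ 'a \<Rightarrow> real ^ 'a ^ 'a" where
  "restrict_mat C M = (\<chi> a b. if a \<in> C \<and> b \<in> C then M $ a $ b else 0)"

definition positive_semidefinite :: "real ^ 'n ^ 'n \<Rightarrow> bool" where
  "positive_semidefinite M \<longleftrightarrow> transpose M = M \<and> (\<forall>x. 0 \<le> x \<bullet> (M *v x))"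

text \<open>The principal square root \<open>M\<^sup>1\<^sup>/\<^sup>2\<close>; meaningful for positive semidefinite \<open>M\<close>, where it is
  the unique positive semidefinite matrix squaring to \<open>M\<close>.\<close>

definition matrix_sqrt :: "real ^ 'n ^ 'n \<Rightarrow> real ^ 'n ^ 'n" where
  "matrix_sqrt M = (THE B. positive_semidefinite B \<and> B ** B = M)"

section \<open>The functions \<open>f\<^sub>C\<close>\<close>

definition cut_fun :: "real ^ 'a \<Rightarrow> real ^ 'a \<Rightarrow> real \<Rightarrow> 'a set \<Rightarrow> real ^ 'a \<Rightarrow> real" where
  "cut_fun \<mu> \<sigma> \<Omega> C x =
     (\<Sum>a\<in>C. \<mu> $ a * x $ a) - \<Omega> * sqrt (\<Sum>a\<in>C. (\<sigma> $ a)\<^sup>2 * x $ a)"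

end

theory Submission
  imports Defs
begin

text \<open>The square root has decreasing increments, which gives supermodularity. Monotonicity is
  subadditivity of the square root together with \<open>\<parallel>\<sigma>\<parallel>\<^sub>2 \<le> \<parallel>\<sigma>\<parallel>\<^sub>1\<close> and \<open>\<Omega> \<sigma> \<le> \<mu>\<close>. The two descriptions of
  the feasible set agree because \<open>x\<^sup>2 = x\<close> for binary \<open>x\<close>, once the principal square root of a
  diagonal matrix has been identified with the entrywise one.\<close>

text \<open>Moving the negative roots across leaves sums of two roots on each side. Their squares
  share the terms \<open>u + v + c\<close>, so only the cross terms matter, and those compare
  because \<open>c * u \<le> c * v\<close>.\<close>

lemma sqrt_increment_antimono:
  fixes u v c :: real
  assumes "0 \<le> u" "u \<le> v" "0 \<le> c"
  shows "sqrt (v + c) - sqrt v \<le> sqrt (u + c) - sqrt u"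
proof -
  have "(sqrt (v + c) + sqrt u)\<^sup>2 \<le> (sqrt (u + c) + sqrt v)\<^sup>2"
  proof -
    have "(v + c) * u \<le> (u + c) * v"
      using assms by (simp add: algebra_simps mult_left_mono)
    then have "sqrt (v + c) * sqrt u \<le> sqrt (u + c) * sqrt v"
      by (simp flip: real_sqrt_mult)
    then show ?thesis
      using assms by (simp add: power2_sum)
  qed
  then have "sqrt (v + c) + sqrt u \<le> sqrt (u + c) + sqrt v"
    by (rule power2_le_imp_le) (use assms in simp)
  then show ?thesis by simp
qed

text \<open>Lets the two set-function properties be proved with sums over
  \<open>C \<inter> S\<close> instead of indicator vectors.\<close>

lemma set_function_cut_fun:
  "set_function (cut_fun \<mu> \<sigma> \<Omega> C) S =
     (\<Sum>a\<in>C \<inter> S. \<mu> $ a) - \<Omega> * sqrt (\<Sum>a\<in>C \<inter> S. (\<sigma> $ a)\<^sup>2)"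
  for C :: "'a::finite set"
proof -
  have "(\<Sum>a\<in>C. f a * indicator S a) = (\<Sum>a\<in>C \<inter> S. f a)" for f :: "'a \<Rightarrow> real"
    by (simp add: sum.inter_restrict indicator_def of_bool_def if_distrib cong: if_cong)
  then show ?thesis
    by (simp add: set_function_def cut_fun_def char_vec_def)
qed

lemma supermodular_on_cut_fun:
  fixes A C :: "'a::finite set"
  assumes "\<Omega> \<ge> 0"
  shows "supermodular_on A (set_function (cut_fun \<mu> \<sigma> \<Omega> C))"
  unfolding supermodular_on_def
proof (intro ballI allI impI, elim conjE)
  fix i S T assume "S \<subseteq> T" "T \<subseteq> A - {i}"
  then have notin: "i \<notin> S" "i \<notin> T" by auto
  let ?g = "set_function (cut_fun \<mu> \<sigma> \<Omega> C)"
  define q where "q X = (\<Sum>a\<in>C \<inter> X. (\<sigma> $ a)\<^sup>2)" for X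
  show "?g (S \<union> {i}) - ?g S \<le> ?g (T \<union> {i}) - ?g T"
  proof (cases "i \<in> C")
    case True
    \<comment> \<open>The linear part adds the same \<open>\<mu> $ i\<close> to every set, so
      marginals differ only through an increment of the root, with fixed step
      \<open>(\<sigma> $ i)\<^sup>2\<close> and base \<open>q X\<close>.\<close>
    have marginal: "?g (X \<union> {i}) - ?g X = \<mu> $ i - \<Omega> * (sqrt (q X + (\<sigma> $ i)\<^sup>2) - sqrt (q X))"
      if "i \<notin> X" for X
      using True that by (simp add: set_function_cut_fun q_def algebra_simps)
    have "q S \<le> q T"
      unfolding q_def using \<open>S \<subseteq> T\<close> by (intro sum_mono2) auto
    then have "sqrt (q T + (\<sigma> $ i)\<^sup>2) - sqrt (q T) \<le> sqrt (q S + (\<sigma> $ i)\<^sup>2) - sqrt (q S)"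
      by (intro sqrt_increment_antimono) (auto simp: q_def sum_nonneg)
    then show ?thesis
      using assms notin by (simp only: marginal diff_left_mono mult_left_mono not_False_eq_True)
  next
    case False
    \<comment> \<open>An arc outside the cut leaves \<open>C \<inter> S\<close> and
      \<open>C \<inter> T\<close> unchanged, so both marginals are 0.\<close>
    then show ?thesis by (simp add: set_function_cut_fun)
  qed
qed

lemma nondecreasing_on_cut_fun:
  fixes A C :: "'a::finite set"
  assumes "C \<subseteq> A" "\<Omega> \<ge> 0"
    and \<sigma>: "\<And>a. a \<in> A \<Longrightarrow> \<sigma> $ a \<ge> 0"
    and \<mu>: "\<And>a. a \<in> A \<Longrightarrow> \<mu> $ a \<ge> \<Omega> * \<sigma> $ a"
  shows "nondecreasing_on A (set_function (cut_fun \<mu> \<sigma> \<Omega> C))"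
  unfolding nondecreasing_on_def
proof (intro allI impI, elim conjE)
  fix S T assume "S \<subseteq> T" "T \<subseteq> A"
  \<comment> \<open>The cut arcs gained from \<open>S\<close> to \<open>T\<close>: their total
    \<open>\<mu>\<close> has to pay for the growth of the root term.\<close>
  define R where "R = C \<inter> (T - S)"
  define q where "q X = (\<Sum>a\<in>X. (\<sigma> $ a)\<^sup>2)" for X
  have "R \<subseteq> A" using \<open>C \<subseteq> A\<close> by (auto simp: R_def)
  have "C \<inter> T = (C \<inter> S) \<union> R" "(C \<inter> S) \<inter> R = {}"
    using \<open>S \<subseteq> T\<close> by (auto simp: R_def)
  then have split: "(\<Sum>a\<in>C \<inter> T. f a) = (\<Sum>a\<in>C \<inter> S. f a) + (\<Sum>a\<in>R. f a)" for f :: "'a \<Rightarrow> real"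
    by (simp add: sum.union_disjoint)
  have "sqrt (q (C \<inter> T)) \<le> sqrt (q (C \<inter> S)) + sqrt (q R)"
    by (simp add: q_def split sqrt_add_le_add_sqrt sum_nonneg)
  moreover have "sqrt (q R) \<le> (\<Sum>a\<in>R. \<sigma> $ a)"
    using L2_set_le_sum[of R "($) \<sigma>"] \<sigma> \<open>R \<subseteq> A\<close> by (auto simp: L2_set_def q_def)
  ultimately have "\<Omega> * sqrt (q (C \<inter> T)) \<le> \<Omega> * (sqrt (q (C \<inter> S)) + (\<Sum>a\<in>R. \<sigma> $ a))"
    using \<open>\<Omega> \<ge> 0\<close> by (intro mult_left_mono) auto
  moreover have "\<Omega> * (\<Sum>a\<in>R. \<sigma> $ a) \<le> (\<Sum>a\<in>R. \<mu> $ a)"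
    unfolding sum_distrib_left using \<mu> \<open>R \<subseteq> A\<close> by (intro sum_mono) auto
  ultimately show "set_function (cut_fun \<mu> \<sigma> \<Omega> C) S \<le> set_function (cut_fun \<mu> \<sigma> \<Omega> C) T"
    by (simp add: set_function_cut_fun q_def split[of "($) \<mu>"] algebra_simps)
qed

text \<open>With \<open>w = B v - l v\<close> we have \<open>B w = - l w\<close>, so positivity of \<open>B\<close> forces \<open>l = 0\<close> or \<open>w = 0\<close>.\<close>

lemma positive_semidefinite_eigenvector_of_square:
  fixes B :: "real ^ 'n ^ 'n"
  assumes psd: "positive_semidefinite B"
    and "l \<ge> 0" and sq: "(B ** B) *v v = l\<^sup>2 *\<^sub>R v"
  shows "B *v v = l *\<^sub>R v"
proof (cases "l = 0")
  case True
  \<comment> \<open>For \<open>l = 0\<close> the sign argument of the other case is void. Symmetry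
    of \<open>B\<close> instead moves one factor across the inner product, where
    \<open>B ** B\<close> kills \<open>v\<close>.\<close>
  have "(B *v v) \<bullet> (B *v v) = v \<bullet> (B *v (B *v v))"
    using psd unfolding positive_semidefinite_def by (metis dot_lmul_matrix vector_transpose_matrix)
  also have "\<dots> = 0"
    using sq True by (simp add: matrix_vector_mul_assoc)
  finally show ?thesis using True by simp
next
  case False
  define w where "w = B *v v - l *\<^sub>R v"
  have "B *v w = - l *\<^sub>R w"
    using sq by (simp add: w_def matrix_vector_mult_diff_distrib matrix_vector_mult_scaleR
        matrix_vector_mul_assoc scaleR_diff_right power2_eq_square)
  moreover have "0 \<le> w \<bullet> (B *v w)"
    using psd by (simp add: positive_semidefinite_def)
  ultimately have "l * (w \<bullet> w) \<le> 0" by simp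
  then have "w \<bullet> w \<le> 0"
    using False \<open>l \<ge> 0\<close> by (simp add: mult_le_0_iff)
  then have "w = 0"
    using inner_gt_zero_iff[of w] by linarith
  then show ?thesis by (simp add: w_def)
qed

lemma diagonal_matrix_mult_vector:
  fixes x :: "real ^ 'n"
  shows "(\<chi> a b. if a = b then m a else 0) *v x = (\<chi> a. m a * x $ a)"
  by (simp add: vec_eq_iff matrix_vector_mult_def if_distrib[of "\<lambda>z. z * _"] cong: if_cong)

text \<open>The definite description needs existence and uniqueness. For uniqueness, each axis
  vector is an eigenvector of \<open>B ** B\<close> for \<open>(m j)\<^sup>2\<close>, hence of
  \<open>B\<close> for \<open>m j\<close>, which fixes every column of \<open>B\<close>.\<close>

lemma matrix_sqrt_diagonal:
  fixes m :: "'n::finite \<Rightarrow> real"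
  assumes "\<And>a. m a \<ge> 0"
  shows "matrix_sqrt (\<chi> a b. if a = b then (m a)\<^sup>2 else 0) = (\<chi> a b. if a = b then m a else 0)"
    (is "matrix_sqrt ?M = ?S")
  unfolding matrix_sqrt_def
proof (rule the_equality)
  have "x $ a * (m a * x $ a) \<ge> 0" for x :: "real ^ 'n" and a
    using assms[of a] by (simp add: mult.left_commute[of _ "m a"])
  then have "positive_semidefinite ?S"
    unfolding positive_semidefinite_def diagonal_matrix_mult_vector
    by (auto simp: transpose_def vec_eq_iff inner_vec_def intro!: sum_nonneg)
  moreover have "?S ** ?S = ?M"
    by (simp add: matrix_eq diagonal_matrix_mult_vector power2_eq_square mult.assoc
        flip: matrix_vector_mul_assoc)
  ultimately show "positive_semidefinite ?S \<and> ?S ** ?S = ?M" ..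
next
  fix B assume B: "positive_semidefinite B \<and> B ** B = ?M"
  then have psd: "positive_semidefinite B" and sq: "B ** B = ?M" by auto
  have diagonal_axis: "(\<chi> a b. if a = b then f a else 0) *v axis j 1 = f j *\<^sub>R axis j 1"
    for f :: "'n \<Rightarrow> real" and j
    by (simp add: diagonal_matrix_mult_vector vec_eq_iff axis_def)
  have "B *v axis j 1 = ?S *v axis j 1" for j
  proof -
    have "(B ** B) *v axis j 1 = (m j)\<^sup>2 *\<^sub>R axis j 1"
      unfolding sq by (rule diagonal_axis)
    with psd assms have "B *v axis j 1 = m j *\<^sub>R axis j 1"
      by (rule positive_semidefinite_eigenvector_of_square)
    then show ?thesis
      by (simp only: diagonal_axis)
  qed
  then have "column j B = column j ?S" for j
    by (simp add: matrix_vector_mult_basis)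
  then show "B = ?S"
    by (simp add: column_def vec_eq_iff)
qed

lemma restrict_cut_constraint:
  fixes A C :: "'a::finite set" and D :: "real ^ 'a ^ 'a"
  assumes "C \<subseteq> A" and x: "x \<in> binary_vectors A"
    and \<sigma>: "\<And>a. a \<in> A \<Longrightarrow> \<sigma> $ a \<ge> 0"
    and D: "\<And>a b. a \<in> A \<Longrightarrow> b \<in> A \<Longrightarrow> D $ a $ b = (if a = b then (\<sigma> $ a)\<^sup>2 else 0)"
  shows "restrict_vec C \<mu> \<bullet> x - \<Omega> * norm (matrix_sqrt (restrict_mat C D) *v x)
           = cut_fun \<mu> \<sigma> \<Omega> C x"
proof -
  \<comment> \<open>Nothing is known about \<open>\<sigma>\<close> and \<open>D\<close> off
    \<open>A\<close>. Padding with zero off \<open>C\<close> makes \<open>m\<close> nonnegative on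
    the whole index type, as the diagonal root requires.\<close>
  define m where "m a = (if a \<in> C then \<sigma> $ a else 0)" for a
  have "m a \<ge> 0" for a
    using \<sigma> \<open>C \<subseteq> A\<close> by (auto simp: m_def)
  moreover have "restrict_mat C D = (\<chi> a b. if a = b then (m a)\<^sup>2 else 0)"
    using D \<open>C \<subseteq> A\<close> by (auto simp: restrict_mat_def m_def vec_eq_iff subset_iff)
  ultimately have root: "matrix_sqrt (restrict_mat C D) *v x = (\<chi> a. m a * x $ a)"
    by (simp add: matrix_sqrt_diagonal diagonal_matrix_mult_vector)
  \<comment> \<open>This holds at every index: off \<open>A\<close> the entries of a binary vector
    are 0.\<close>
  have "(x $ a)\<^sup>2 = x $ a" for a
    using x by (cases "a \<in> A") (auto simp: binary_vectors_def)
  then have "norm (\<chi> a. m a * x $ a) = sqrt (\<Sum>a\<in>UNIV. (m a)\<^sup>2 * x $ a)"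
    by (simp add: norm_vec_def L2_set_def power_mult_distrib)
  also have "(\<Sum>a\<in>UNIV. (m a)\<^sup>2 * x $ a) = (\<Sum>a\<in>C. (\<sigma> $ a)\<^sup>2 * x $ a)"
    by (rule sum.mono_neutral_cong_right) (auto simp: m_def)
  finally have "norm (matrix_sqrt (restrict_mat C D) *v x) = sqrt (\<Sum>a\<in>C. (\<sigma> $ a)\<^sup>2 * x $ a)"
    by (simp add: root)
  moreover have "restrict_vec C \<mu> \<bullet> x = (\<Sum>a\<in>C. \<mu> $ a * x $ a)"
    unfolding inner_vec_def by (rule sum.mono_neutral_cong_right) (auto simp: restrict_vec_def)
  ultimately show ?thesis by (simp add: cut_fun_def)
qed

theorem mainTheorem2:
  fixes G :: "('v, 'a :: finite) pre_digraph"
    and s t :: 'v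
    and d \<Omega> :: real
    and \<mu> \<sigma> :: "real ^ 'a"
    and D :: "real ^ 'a ^ 'a"
  assumes "fin_digraph G"
    and "s \<in> verts G" and "t \<in> verts G" and "s \<noteq> t"
    and "\<Omega> \<ge> 0"
    and "\<And>a. a \<in> arcs G \<Longrightarrow> \<sigma> $ a \<ge> 0"
    and "\<And>a. a \<in> arcs G \<Longrightarrow> \<mu> $ a \<ge> \<Omega> * \<sigma> $ a"
    and "\<And>a b. a \<in> arcs G \<Longrightarrow> b \<in> arcs G \<Longrightarrow> D $ a $ b = (if a = b then (\<sigma> $ a)\<^sup>2 else 0)"
  shows "(\<forall>C \<in> st_cuts G s t.
            nondecreasing_on (arcs G) (set_function (cut_fun \<mu> \<sigma> \<Omega> C)) \<and>
            supermodular_on (arcs G) (set_function (cut_fun \<mu> \<sigma> \<Omega> C)))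
       \<and> {x \<in> binary_vectors (arcs G). \<forall>C \<in> st_cuts G s t.
            restrict_vec C \<mu> \<bullet> x - \<Omega> * norm (matrix_sqrt (restrict_mat C D) *v x) \<ge> d}
         = (\<Inter>C \<in> st_cuts G s t. {x \<in> binary_vectors (arcs G). cut_fun \<mu> \<sigma> \<Omega> C x \<ge> d})
       \<and> (\<forall>C \<in> st_cuts G s t. monotone_supermodular_covering_knapsack (arcs G)
            {x \<in> binary_vectors (arcs G). cut_fun \<mu> \<sigma> \<Omega> C x \<ge> d})"
proof -
  let ?K = "\<lambda>C. {x \<in> binary_vectors (arcs G). cut_fun \<mu> \<sigma> \<Omega> C x \<ge> d}"
  have cut: "C \<subseteq> arcs G" if "C \<in> st_cuts G s t" for C
    using that by (auto simp: st_cuts_def)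
  \<comment> \<open>Without a cut, the intersection would be all of \<open>UNIV\<close> rather than the binary vectors.\<close>
  have nonempty: "st_cuts G s t \<noteq> {}"
    using assms(2,4) unfolding st_cuts_def by blast
  have mono: "nondecreasing_on (arcs G) (set_function (cut_fun \<mu> \<sigma> \<Omega> C))"
    if "C \<in> st_cuts G s t" for C
    using cut[OF that] assms(5-7) by (rule nondecreasing_on_cut_fun)
  have super: "supermodular_on (arcs G) (set_function (cut_fun \<mu> \<sigma> \<Omega> C))" for C
    using assms(5) by (rule supermodular_on_cut_fun)
  \<comment> \<open>The two constraint functions are compared on binary vectors only; this suffices
    since both feasible sets consist of such vectors.\<close>
  have "restrict_vec C \<mu> \<bullet> x - \<Omega> * norm (matrix_sqrt (restrict_mat C D) *v x) = cut_fun \<mu> \<sigma> \<Omega> C x"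
    if "C \<in> st_cuts G s t" "x \<in> binary_vectors (arcs G)" for C x
    using cut[OF that(1)] that(2) assms(6,8) by (rule restrict_cut_constraint)
  then have "{x \<in> binary_vectors (arcs G). \<forall>C \<in> st_cuts G s t.
      restrict_vec C \<mu> \<bullet> x - \<Omega> * norm (matrix_sqrt (restrict_mat C D) *v x) \<ge> d}
    = (\<Inter>C \<in> st_cuts G s t. ?K C)"
    using nonempty by auto
  moreover have "monotone_supermodular_covering_knapsack (arcs G) (?K C)"
    if "C \<in> st_cuts G s t" for C
    \<comment> \<open>The witnesses are \<open>cut_fun \<mu> \<sigma> \<Omega> C\<close> and the
      given \<open>d\<close>.\<close>
    unfolding monotone_supermodular_covering_knapsack_def using mono[OF that] super by blast
  ultimately show ?thesis
    using mono super by blast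
qed

end
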